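(* Let $\alpha>0$ and let $X=\{(\lambda,m_\lambda)\}_{\lambda\in\Lambda}$ be a divisor. If there exists a compact subset $K$ of $\mathbb C$ such that $$\bigcup_{\lambda\in\Lambda} D\bigl(\lambda,\sqrt{m_\lambda/\alpha}\bigr)=\mathbb C\setminus K,$$ then $X$ is not a zero divisor for $\mathcal F_\alpha^2$.
   Context: For $\alpha>0$, the Fock space is $$\mathcal F_\alpha^2=\Bigl\{f\in \operatorname{Hol}(\mathbb C): \frac{\alpha}{\pi}\int_{\mathbb C}|f(z)|^2e^{-\alpha|z|^2}\,dm(z)<\infty\Bigr\},$$ where $\operatorname{Hol}(\mathbb C)$ is the set of entire functions and $m$ is planar Lebesgue measure. A divisor $X=\{(\lambda,m_\lambda)\}_{\lambda\in\Lambda}$ consists of a sequence $\Lambda$ of (distinct) points in $\mathbb C$ and, for each $\lambda\in\Lambda$, a positive integer $m_\lambda$ (the multiplicity associated with $\lambda$). $X$ is a zero divisor for $\mathcal F_\alpha^2$ if there is a function $f\in\mathcal F_\alpha^2$, $f\not\equiv 0$, whose zero set is exactly $\Lambda$ and which has a zero of order exactly $m_\lambda$ at each $\lambda\in\Lambda$. $D(z,r)$ denotes the (open) disc of radius $r$ centered at $z$. *)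

theory Defs
  imports "HOL-Analysis.Analysis" "HOL-Complex_Analysis.Complex_Analysis"
begin

definition Fock_space :: "real \<Rightarrow> (complex \<Rightarrow> complex) set" where
  "Fock_space \<alpha> =
     {f. f holomorphic_on UNIV \<and>
         ennreal (\<alpha> / pi) *
           (\<integral>\<^sup>+ z. ennreal ((cmod (f z))\<^sup>2 * exp (- \<alpha> * (cmod z)\<^sup>2)) \<partial>lborel) < \<infinity>}"

text \<open>
  A divisor is given by its set of (pairwise distinct) points and a multiplicity function,
  whose values off that set are irrelevant.  Countability expresses that the points form a
  finite or infinite sequence; no discreteness is required.
\<close>

definition divisor :: "complex set \<Rightarrow> (complex \<Rightarrow> nat) \<Rightarrow> bool" where
  "divisor \<Lambda> m \<longleftrightarrow> countable \<Lambda> \<and> (\<forall>w\<in>\<Lambda>. m w > 0)"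

definition zero_divisor_Fock :: "real \<Rightarrow> complex set \<Rightarrow> (complex \<Rightarrow> nat) \<Rightarrow> bool" where
  "zero_divisor_Fock \<alpha> \<Lambda> m \<longleftrightarrow>
     (\<exists>f\<in>Fock_space \<alpha>. f \<noteq> (\<lambda>_. 0) \<and> {z. f z = 0} = \<Lambda> \<and>
        (\<forall>w\<in>\<Lambda>. zorder f w = int (m w)))"

end

theory Submission
  imports Defs
begin

text \<open>
  Write \<open>r w = sqrt (m w / \<alpha>)\<close> and suppose that a nonzero \<open>f\<close> in the Fock space has the
  given zero divisor.  Then \<open>log (|f(z)|^2 exp (- \<alpha> |z|^2))\<close> is bounded above
  (\<open>Fock_space_weighted_bounded\<close>).  Its Laplacian consists of point masses \<open>4 pi (m w)\<close> at the
  zeros and of the density \<open>- 4 \<alpha>\<close>; the radius \<open>r w\<close> is chosen so that the point mass at \<open>w\<close>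
  equals the mass of the density \<open>4 \<alpha>\<close> on the disc of radius \<open>r w\<close>.  Spreading each point mass
  uniformly over its disc, that is, dividing out \<open>(z - w) ^ m w\<close> and adding \<open>\<alpha>\<close> times
  \<open>disc_potential w (r w)\<close> and a constant, leaves the function unchanged off the disc, raises it
  inside, and makes it subharmonic wherever a disc covers.

  If the discs covered the whole plane, the maximum principle on unions of finitely many discs
  would nearly finish the proof.  Two points remain: the hole \<open>K\<close>, where the density stays
  negative, and the fact that boundedness alone does not push the boundary values down.  Both are
  settled by the surplus of mass that overlapping discs carry.  All radii are at least
  \<open>s = sqrt (1 / \<alpha>)\<close>, and open discs of radius at least \<open>s\<close> cannot cover a neighbourhood of
  infinity without overlapping in discs of radius \<open>s / 8\<close> arbitrarily far away
  (\<open>disc_cover_overlap\<close>).  Choose finitely many such overlap discs, pairwise disjoint, of total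
  area larger than that of a disc \<open>D(0, R0)\<close> containing \<open>K\<close>.  Moving the surplus from them into
  \<open>D(0, R0)\<close> adds the potential of \<open>D(0, R0)\<close> and subtracts those of the overlap discs.  The
  sum stays subharmonic on every union of \<open>D(0, R0)\<close> with finitely many discs that include those
  forming the overlaps (\<open>harmonic_support_balanced_discs\<close>), and the added term tends to
  \<open>- \<infinity>\<close> at infinity because more mass was taken away than put in
  (\<open>disc_potential_diff_small_near_infinity\<close>).  Such a union can be made to contain any large
  disc, so the maximum principle bounds a fixed positive value by boundary values that tend to
  zero.

  Subharmonicity is used in one form only: at each point there is a touching harmonic minorant.
  This is stable under sums, is easily checked for the explicit potentials, and reduces the
  maximum principle to the maximum modulus principle for holomorphic functions.
\<close>

section \<open>Pointwise bounds in the Fock space\<close>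

text \<open>
  Transporting to pairs of reals reduces this to the invariance of Lebesgue measure under
  orthogonal transformations.
\<close>
lemma emeasure_lborel_rotation_vimage_box:
  fixes c :: complex and l u :: complex
  assumes c: "cmod c = 1"
  shows "emeasure lborel ((*) c -` box l u) = emeasure lborel (box l u)"
proof -
  define \<Phi> :: "real^2 \<Rightarrow> complex" where "\<Phi> v = Complex (vec_nth v 1) (vec_nth v 2)" for v
  define \<Psi> :: "complex \<Rightarrow> real^2" where "\<Psi> z = vector [Re z, Im z]" for z
  have \<Phi>\<Psi>: "\<Phi> (\<Psi> z) = z" for z by (simp add: \<Phi>_def \<Psi>_def)
  have \<Psi>\<Phi>: "\<Psi> (\<Phi> v) = v" for v by (simp add: \<Phi>_def \<Psi>_def vec_eq_iff forall_2)
  have lin\<Phi>: "linear \<Phi>"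
    by (rule linearI) (auto simp: \<Phi>_def complex_eq_iff)
  have lin\<Psi>: "linear \<Psi>"
    by (rule linearI) (auto simp: \<Psi>_def vec_eq_iff forall_2)
  have inner\<Phi>: "\<Phi> x \<bullet> \<Phi> y = x \<bullet> y" for x y
    by (simp add: \<Phi>_def inner_complex_def inner_vec_def sum_2)
  have inner\<Psi>: "\<Psi> x \<bullet> \<Psi> y = x \<bullet> y" for x y
    by (metis \<Phi>\<Psi> inner\<Phi>)
  have meas\<Phi>: "\<Phi> \<in> borel_measurable borel"
    by (intro borel_measurable_continuous_onI linear_continuous_on)
       (use lin\<Phi> linear_conv_bounded_linear in blast)
  \<comment> \<open>coordinates carry Lebesgue measure on the plane of real pairs to the one on the complex plane\<close>
  have lb: "lborel = distr lborel borel \<Phi>"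
  proof (rule lborel_eqI)
    fix l u :: complex assume lu: "\<And>b. b \<in> Basis \<Longrightarrow> l \<bullet> b \<le> u \<bullet> b"
    have le: "Re l \<le> Re u" "Im l \<le> Im u" using lu[of 1] lu[of \<i>] by (auto simp: Basis_complex_def)
    have "\<Phi> -` box l u = box (\<Psi> l) (\<Psi> u)"
      by (auto simp: mem_box_cart forall_2 \<Phi>_def \<Psi>_def in_box_complex_iff)
    then have "emeasure (distr lborel borel \<Phi>) (box l u) = emeasure lborel (box (\<Psi> l) (\<Psi> u))"
      using meas\<Phi> by (simp add: emeasure_distr)
    also have "\<dots> = (\<Prod>b\<in>Basis. (u - l) \<bullet> b)"
    proof -
      have B: "(Basis :: (real^2) set) = {axis 1 1, axis 2 1}"
        by (auto simp: Basis_vec_def UNIV_2)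
      have ne: "axis 1 1 \<noteq> (axis 2 1 :: real^2)" by (simp add: axis_eq_axis)
      have "emeasure lborel (box (\<Psi> l) (\<Psi> u)) = (\<Prod>b\<in>Basis. (\<Psi> u - \<Psi> l) \<bullet> b)"
        by (rule emeasure_lborel_box) (use le in \<open>auto simp: B \<Psi>_def inner_axis\<close>)
      also have "(\<Prod>b\<in>Basis. (\<Psi> u - \<Psi> l) \<bullet> b) = (\<Prod>b\<in>Basis. (u - l) \<bullet> b)"
        using ne by (simp add: B \<Psi>_def Basis_complex_def inner_axis)
      finally show ?thesis .
    qed
    finally show "emeasure (distr lborel borel \<Phi>) (box l u) = (\<Prod>b\<in>Basis. (u - l) \<bullet> b)" .
  qed simp
  have emb: "emeasure lborel A = emeasure lborel (\<Phi> -` A)" if "A \<in> sets borel" for A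
    by (subst lb) (use that meas\<Phi> in \<open>simp add: emeasure_distr\<close>)
  define T where "T v = \<Psi> (\<Phi> v / c)" for v
  have c0: "c \<noteq> 0" using c by auto
  have ortho: "orthogonal_transformation T"
    unfolding orthogonal_transformation_def
  proof (intro conjI allI)
    have "linear (\<lambda>z::complex. z / c)" by (rule linearI) (auto simp: add_divide_distrib scaleR_conv_of_real)
    then show "linear T" unfolding T_def
      using linear_compose[OF linear_compose[OF lin\<Phi>] lin\<Psi>] by (simp add: o_def)
    have "(x / c) \<bullet> (y / c) = x \<bullet> y" for x y
    proof -
      have ip: "v \<bullet> w = Re (v * cnj w)" for v w :: complex by (simp add: inner_complex_def)
      have "(x / c) \<bullet> (y / c) = Re ((x / c) * cnj (y / c))" by (rule ip)
      also have "(x / c) * cnj (y / c) = x * cnj y / (c * cnj c)" by simp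
      also have "c * cnj c = 1" using c by (metis complex_norm_square of_real_1 one_power2)
      finally show ?thesis by (simp add: ip)
    qed
    then show "T v \<bullet> T w = v \<bullet> w" for v w by (simp add: T_def inner\<Psi> inner\<Phi>)
  qed
  define B where "B = \<Phi> -` box l u"
  have Bbox: "B = box (\<Psi> l) (\<Psi> u)"
    by (auto simp: B_def mem_box_cart forall_2 \<Phi>_def \<Psi>_def in_box_complex_iff)
  have im: "\<Phi> -` ((*) c -` box l u) = T ` B"
  proof (intro set_eqI iffI)
    fix v assume "v \<in> \<Phi> -` ((*) c -` box l u)"
    then have "\<Psi> (c * \<Phi> v) \<in> B" "T (\<Psi> (c * \<Phi> v)) = v"
      using c0 by (auto simp: B_def T_def \<Phi>\<Psi> \<Psi>\<Phi>)
    then show "v \<in> T ` B" by (metis image_eqI)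
  qed (use c0 in \<open>auto simp: B_def T_def \<Phi>\<Psi>\<close>)
  have "open ((*) c -` box l u)" by (intro open_vimage continuous_intros) auto
  then have o: "(*) c -` box l u \<in> sets borel" by simp
  have TB: "T ` B \<in> sets borel"
  proof -
    have "\<Phi> -` ((*) c -` box l u) \<inter> space borel \<in> sets borel" using meas\<Phi> o by (rule measurable_sets)
    then show ?thesis by (simp add: im)
  qed
  have Bm: "B \<in> lmeasurable" by (simp add: Bbox)
  have "emeasure lborel ((*) c -` box l u) = emeasure lborel (T ` B)"
    by (simp add: emb[OF o] im)
  also have "\<dots> = emeasure lebesgue (T ` B)" using TB by simp
  also have "\<dots> = ennreal (measure lebesgue (T ` B))"
    by (rule emeasure_eq_measure2) (rule measurable_orthogonal_image[OF ortho Bm])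
  also have "measure lebesgue (T ` B) = measure lebesgue B"
    by (rule measure_orthogonal_image[OF ortho Bm])
  also have "ennreal \<dots> = emeasure lebesgue B" by (rule emeasure_eq_measure2[symmetric, OF Bm])
  also have "\<dots> = emeasure lborel B" by (simp add: Bbox)
  also have "\<dots> = emeasure lborel (box l u)" by (simp add: emb B_def)
  finally show ?thesis .
qed

lemma lborel_rotation_invariant:
  fixes c :: complex
  assumes c: "cmod c = 1"
  shows "distr lborel borel ((*) c) = lborel"
proof (rule sym, rule lborel_eqI)
  fix l u :: complex assume "\<And>b. b \<in> Basis \<Longrightarrow> l \<bullet> b \<le> u \<bullet> b"
  then show "emeasure (distr lborel borel ((*) c)) (box l u) = (\<Prod>b\<in>Basis. (u - l) \<bullet> b)"
    using emeasure_lborel_rotation_vimage_box[OF c, of l u]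
    by (simp add: emeasure_distr emeasure_lborel_box)
qed simp

text \<open>
  Cauchy's formula for \<open>w \<mapsto> g (u * w)\<close> on the unit circle.  Writing the points as
  \<open>u * cis t\<close> rather than in terms of a radius makes averaging over \<open>u\<close> a matter of
  rotation invariance, so that polar coordinates do not enter.
\<close>
lemma entire_circle_mean:
  fixes g :: "complex \<Rightarrow> complex"
  assumes g: "g holomorphic_on UNIV"
  shows "ennreal (2 * pi * cmod (g 0)) \<le> (\<integral>\<^sup>+t\<in>{0..2*pi}. ennreal (cmod (g (u * cis t))) \<partial>lborel)"
proof -
  have h: "(\<lambda>w. g (u * w)) holomorphic_on UNIV"
    by (intro holomorphic_on_compose_gen[OF _ g, unfolded o_def] holomorphic_intros) auto
  have "((\<lambda>w. g (u * w) / (w - 0)) has_contour_integral (2 * of_real pi * \<i> * g (u * 0))) (circlepath 0 1)"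
    by (rule Cauchy_integral_circlepath_simple) (use h holomorphic_on_subset in auto)
  then have "((\<lambda>t. g (u * cis t) * \<i>) has_integral (2 * of_real pi * \<i> * g 0)) {0..2*pi}"
    unfolding circlepath_def by (subst (asm) has_contour_integral_part_circlepath_iff) auto
  then have "((\<lambda>t. g (u * cis t) * \<i> * (- \<i>)) has_integral (2 * of_real pi * \<i> * g 0 * (- \<i>))) {0..2*pi}"
    by (rule has_integral_mult_left)
  moreover have "v * \<i> * (- \<i>) = v" "2 * of_real pi * \<i> * v * (- \<i>) = 2 * of_real pi * v" for v :: complex
    by (simp_all add: complex_eq_iff)
  ultimately have I: "((\<lambda>t. g (u * cis t)) has_integral (2 * of_real pi * g 0)) {0..2*pi}"
    by (simp only:)
  have cg: "continuous_on A g" for A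
    using g holomorphic_on_imp_continuous_on continuous_on_subset by blast
  have cn: "continuous_on A (\<lambda>t. cmod (g (u * cis t)))" for A
    by (intro continuous_intros continuous_on_compose2[OF cg[of UNIV]]) auto
  have int: "(\<lambda>t. cmod (g (u * cis t))) integrable_on {0..2*pi}"
    by (intro integrable_continuous_interval cn)
  have "2 * pi * cmod (g 0) = norm (integral {0..2*pi} (\<lambda>t. g (u * cis t)))"
    using I by (simp add: integral_unique norm_mult)
  also have "\<dots> \<le> integral {0..2*pi} (\<lambda>t. cmod (g (u * cis t)))"
    by (rule integral_norm_bound_integral[OF has_integral_integrable[OF I] int]) simp
  finally have le: "2 * pi * cmod (g 0) \<le> integral {0..2*pi} (\<lambda>t. cmod (g (u * cis t)))" .
  have si: "set_integrable lborel {0..2*pi} (\<lambda>t. cmod (g (u * cis t)))"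
    by (rule borel_integrable_atLeastAtMost') (rule cn)
  then have "(\<integral>\<^sup>+t\<in>{0..2*pi}. ennreal (cmod (g (u * cis t))) \<partial>lborel) = ennreal (integral {0..2*pi} (\<lambda>t. cmod (g (u * cis t))))"
    by (subst set_borel_integral_eq_integral(2)[symmetric])
       (auto simp: set_lebesgue_integral_def set_integrable_def nn_integral_eq_integral[symmetric] indicator_def intro!: nn_integral_cong)
  then show ?thesis using le by (simp add: ennreal_leI)
qed

text \<open>
  Integrate the inequality for circles over \<open>u\<close> in the unit disc and exchange the two
  integrations: for each angle the inner integral is the one for angle zero.
\<close>
lemma entire_area_mean:
  fixes g :: "complex \<Rightarrow> complex"
  assumes g: "g holomorphic_on UNIV"
  shows "ennreal (cmod (g 0)) * emeasure lborel (ball (0::complex) 1)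
           \<le> (\<integral>\<^sup>+u\<in>ball 0 1. ennreal (cmod (g u)) \<partial>lborel)"
proof -
  have cg: "continuous_on UNIV g" using g holomorphic_on_imp_continuous_on by blast
  then have mg[measurable]: "g \<in> borel_measurable borel" by (rule borel_measurable_continuous_onI)
  have [measurable]: "cis \<in> borel_measurable borel"
    by (intro borel_measurable_continuous_onI continuous_intros)
  let ?B = "ball (0::complex) 1"
  have [measurable]: "?B \<in> sets borel" "Measurable.pred borel (\<lambda>x::complex. x \<in> ?B)" by simp_all
  have rot: "(\<integral>\<^sup>+u\<in>?B. ennreal (cmod (g (u * cis t))) \<partial>lborel) = (\<integral>\<^sup>+u\<in>?B. ennreal (cmod (g u)) \<partial>lborel)" for t
  proof -
    have "(\<integral>\<^sup>+u\<in>?B. ennreal (cmod (g u)) \<partial>lborel) = (\<integral>\<^sup>+u\<in>?B. ennreal (cmod (g u)) \<partial>distr lborel borel ((*) (cis t)))"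
      by (simp add: lborel_rotation_invariant)
    also have "\<dots> = (\<integral>\<^sup>+u. ennreal (cmod (g (cis t * u))) * indicator ?B (cis t * u) \<partial>lborel)"
      by (rule nn_integral_distr) measurable
    also have "\<dots> = (\<integral>\<^sup>+u\<in>?B. ennreal (cmod (g (u * cis t))) \<partial>lborel)"
      by (intro nn_integral_cong) (auto simp: indicator_def norm_mult mult.commute)
    finally show ?thesis by simp
  qed
  have "ennreal (2 * pi) * (ennreal (cmod (g 0)) * emeasure lborel ?B)
      = (\<integral>\<^sup>+u\<in>?B. ennreal (2 * pi * cmod (g 0)) \<partial>lborel)"
    by (simp add: nn_integral_cmult ennreal_mult' mult.assoc)
  also have "\<dots> \<le> (\<integral>\<^sup>+u\<in>?B. (\<integral>\<^sup>+t\<in>{0..2*pi}. ennreal (cmod (g (u * cis t))) \<partial>lborel) \<partial>lborel)"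
    by (intro nn_integral_mono mult_right_mono entire_circle_mean[OF g]) simp
  also have "\<dots> = (\<integral>\<^sup>+u. (\<integral>\<^sup>+t. ennreal (cmod (g (u * cis t))) * indicator {0..2*pi} t * indicator ?B u \<partial>lborel) \<partial>lborel)"
    by (intro nn_integral_cong nn_integral_multc[symmetric]) measurable
  also have "\<dots> = (\<integral>\<^sup>+t. (\<integral>\<^sup>+u. ennreal (cmod (g (u * cis t))) * indicator {0..2*pi} t * indicator ?B u \<partial>lborel) \<partial>lborel)"
    by (rule lborel_pair.Fubini'[symmetric]) measurable
  also have "\<dots> = (\<integral>\<^sup>+t. (\<integral>\<^sup>+u\<in>?B. ennreal (cmod (g (u * cis t))) \<partial>lborel) * indicator {0..2*pi} t \<partial>lborel)"
    by (subst nn_integral_multc[symmetric]) (auto intro!: nn_integral_cong simp: mult_ac)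
  also have "\<dots> = (\<integral>\<^sup>+t\<in>{0..2*pi}. (\<integral>\<^sup>+u\<in>?B. ennreal (cmod (g u)) \<partial>lborel) \<partial>lborel)"
    by (simp add: rot)
  also have "\<dots> = ennreal (2 * pi) * (\<integral>\<^sup>+u\<in>?B. ennreal (cmod (g u)) \<partial>lborel)"
    by (subst nn_integral_cmult_indicator) (simp_all add: mult.commute)
  finally show ?thesis
    by (subst (asm) ennreal_mult_le_mult_iff) auto
qed

text \<open>
  Translation followed by multiplication with an exponential preserves the Fock norm.  The factor
  \<open>exp (- \<alpha> * cnj z * u)\<close> absorbs the cross term of \<open>|z + u|^2\<close>, so the weighted square of
  \<open>f\<close> near \<open>z\<close> is comparable with the modulus of an entire function, to which the area mean
  inequality applies.
\<close>
lemma Fock_space_weighted_bounded: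
  assumes \<alpha>: "\<alpha> > 0" and f: "f \<in> Fock_space \<alpha>"
  obtains C where "\<And>z. (cmod (f z))\<^sup>2 * exp (- \<alpha> * (cmod z)\<^sup>2) \<le> C"
proof -
  let ?B = "ball (0::complex) 1"
  define J where "J = (\<integral>\<^sup>+ z. ennreal ((cmod (f z))\<^sup>2 * exp (- \<alpha> * (cmod z)\<^sup>2)) \<partial>lborel)"
  define b where "b = measure lborel ?B"
  have hf: "f holomorphic_on UNIV" and "ennreal (\<alpha> / pi) * J < \<infinity>"
    using f by (auto simp: Fock_space_def J_def)
  then have "J < \<infinity>" using \<alpha>
    by (auto simp: ennreal_mult_less_top less_top)
  then obtain j where j: "J = ennreal j" "j \<ge> 0" by (cases J) auto
  have eb: "emeasure lborel ?B = ennreal b"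
    unfolding b_def by (rule emeasure_eq_ennreal_measure) (use emeasure_lborel_ball_finite[of "0::complex" 1] in simp)
  have bpos: "b > 0"
    unfolding b_def by (simp add: content_ball_pos)
  have cf: "continuous_on UNIV f" using hf holomorphic_on_imp_continuous_on by blast
  have [measurable]: "f \<in> borel_measurable borel" using cf by (rule borel_measurable_continuous_onI)
  show ?thesis
  proof
    fix z
    define g where "g u = (f (z + u) * exp (- of_real \<alpha> * cnj z * u))\<^sup>2" for u
    have hg: "g holomorphic_on UNIV" unfolding g_def
      by (intro holomorphic_intros holomorphic_on_compose_gen[OF _ hf, unfolded o_def]) auto
    have key: "exp (- \<alpha> * (cmod z)\<^sup>2) * exp (- \<alpha>) * cmod (g u) \<le> (cmod (f (z + u)))\<^sup>2 * exp (- \<alpha> * (cmod (z + u))\<^sup>2)"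
      if u: "u \<in> ?B" for u
    proof -
      have "(cmod (z + u))\<^sup>2 = (cmod z)\<^sup>2 + 2 * Re (cnj z * u) + (cmod u)\<^sup>2"
        by (simp only: cmod_power2) (simp add: power2_eq_square algebra_simps)
      moreover have "(cmod u)\<^sup>2 \<le> 1" using u by (simp add: power_le_one)
      ultimately have "- \<alpha> * (cmod z)\<^sup>2 + - \<alpha> + 2 * (- \<alpha> * Re (cnj z * u)) \<le> - \<alpha> * (cmod (z + u))\<^sup>2"
        using \<alpha> by (simp add: algebra_simps)
      then have "exp (- \<alpha> * (cmod z)\<^sup>2) * exp (- \<alpha>) * (exp (- \<alpha> * Re (cnj z * u)))\<^sup>2 \<le> exp (- \<alpha> * (cmod (z + u))\<^sup>2)"
        by (simp add: exp_add[symmetric] exp_double[symmetric])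
      then have "(cmod (f (z+u)))\<^sup>2 * (exp (- \<alpha> * (cmod z)\<^sup>2) * exp (- \<alpha>) * (exp (- \<alpha> * Re (cnj z * u)))\<^sup>2) \<le> (cmod (f (z+u)))\<^sup>2 * exp (- \<alpha> * (cmod (z + u))\<^sup>2)"
        by (rule mult_left_mono) simp
      moreover have "cmod (g u) = (cmod (f (z+u)))\<^sup>2 * (exp (- \<alpha> * Re (cnj z * u)))\<^sup>2"
        by (simp add: g_def norm_mult norm_power power_mult_distrib mult.assoc)
      ultimately show ?thesis by (simp add: mult_ac)
    qed
    define k where "k = exp (- \<alpha> * (cmod z)\<^sup>2) * exp (- \<alpha>)"
    have k0: "k \<ge> 0" by (simp add: k_def)
    have mg[measurable]: "g \<in> borel_measurable borel"
      using hg holomorphic_on_imp_continuous_on by (intro borel_measurable_continuous_onI) blast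
    have "ennreal (k * cmod (g 0) * b) = ennreal k * (ennreal (cmod (g 0)) * emeasure lborel ?B)"
      using k0 bpos by (simp add: eb ennreal_mult' mult.assoc)
    also have "\<dots> \<le> ennreal k * (\<integral>\<^sup>+u\<in>?B. ennreal (cmod (g u)) \<partial>lborel)"
      by (intro mult_left_mono entire_area_mean[OF hg]) simp
    also have "\<dots> = (\<integral>\<^sup>+u. ennreal k * (ennreal (cmod (g u)) * indicator ?B u) \<partial>lborel)"
      by (rule nn_integral_cmult[symmetric]) (auto intro!: borel_measurable_times_ennreal borel_measurable_indicator)
    also have "\<dots> \<le> (\<integral>\<^sup>+u. ennreal ((cmod (f (z + u)))\<^sup>2 * exp (- \<alpha> * (cmod (z + u))\<^sup>2)) \<partial>lborel)"
    proof (rule nn_integral_mono)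
      fix u
      show "ennreal k * (ennreal (cmod (g u)) * indicator ?B u) \<le> ennreal ((cmod (f (z + u)))\<^sup>2 * exp (- \<alpha> * (cmod (z + u))\<^sup>2))"
        using key[of u] k0 by (cases "u \<in> ?B") (simp_all add: k_def ennreal_mult'[symmetric] ennreal_leI)
    qed
    also have "\<dots> = (\<integral>\<^sup>+u. ennreal ((cmod (f u))\<^sup>2 * exp (- \<alpha> * (cmod u)\<^sup>2)) \<partial>distr lborel borel ((+) z))"
      by (rule nn_integral_distr[symmetric]) measurable
    also have "\<dots> = ennreal j" by (simp add: lborel_distr_plus J_def j(1)[symmetric])
    finally have "k * cmod (g 0) * b \<le> j" using j(2) by (simp add: ennreal_le_iff)
    then show "(cmod (f z))\<^sup>2 * exp (- \<alpha> * (cmod z)\<^sup>2) \<le> j / b * exp \<alpha>"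
      using bpos by (simp add: k_def g_def norm_power exp_minus field_simps)
  qed
qed

section \<open>Potentials of discs and a maximum principle\<close>

text \<open>
  The potential of a uniform mass on the disc, with Laplacian \<open>4\<close> inside and \<open>0\<close> outside,
  normalised to equal \<open>|z - a|^2\<close> inside; the logarithm outside is the continuously
  differentiable radial harmonic continuation.
\<close>
definition disc_potential :: "complex \<Rightarrow> real \<Rightarrow> complex \<Rightarrow> real" where
  "disc_potential a r z =
     (if cmod (z - a) \<le> r then (cmod (z - a))\<^sup>2 else r\<^sup>2 * (1 + ln ((cmod (z - a))\<^sup>2 / r\<^sup>2)))"

text \<open>
  Both this bound and the next one are the inequality \<open>1 + ln x \<le> x\<close>.
\<close>
lemma disc_potential_le:
  assumes r: "r > 0"
  shows "disc_potential a r z \<le> (cmod (z - a))\<^sup>2"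
proof (cases "cmod (z - a) \<le> r")
  case False
  define x where "x = (cmod (z - a))\<^sup>2 / r\<^sup>2"
  have "z \<noteq> a" using False r by auto
  then have x: "x > 0" using r by (simp add: x_def)
  have "1 + ln x \<le> x" using ln_le_minus_one[OF x] by simp
  then have "r\<^sup>2 * (1 + ln x) \<le> r\<^sup>2 * x" by (rule mult_left_mono) simp
  also have "\<dots> = (cmod (z - a))\<^sup>2" using r by (simp add: x_def)
  finally show ?thesis using False by (simp add: disc_potential_def x_def)
qed (simp add: disc_potential_def)

lemma disc_potential_ge:
  assumes r: "r > 0" and za: "z \<noteq> a"
  shows "disc_potential a r z \<ge> r\<^sup>2 * (1 + ln ((cmod (z - a))\<^sup>2 / r\<^sup>2))"
proof (cases "cmod (z - a) \<le> r")
  case True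
  define x where "x = (cmod (z - a))\<^sup>2 / r\<^sup>2"
  have x: "x > 0" using za r by (simp add: x_def)
  have "1 + ln x \<le> x" using ln_le_minus_one[OF x] by simp
  then have "r\<^sup>2 * (1 + ln x) \<le> r\<^sup>2 * x" by (rule mult_left_mono) simp
  also have "\<dots> = (cmod (z - a))\<^sup>2" using r by (simp add: x_def)
  finally show ?thesis using True by (simp add: disc_potential_def x_def)
qed (simp add: disc_potential_def)

lemma disc_potential_outside:
  assumes r: "r > 0" and "cmod (z - a) \<ge> r"
  shows "disc_potential a r z = r\<^sup>2 * (1 + ln ((cmod (z - a))\<^sup>2 / r\<^sup>2))"
  using assms by (auto simp: disc_potential_def)

lemma continuous_on_disc_potential:
  assumes r: "r > 0"
  shows "continuous_on UNIV (disc_potential a r)"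
proof -
  have "continuous_on ({z. cmod (z - a) \<le> r} \<union> {z. r \<le> cmod (z - a)})
     (\<lambda>z. if cmod (z - a) \<le> r then (cmod (z - a))\<^sup>2 else r\<^sup>2 * (1 + ln ((cmod (z - a))\<^sup>2 / r\<^sup>2)))"
    by (rule continuous_on_If)
       (use r in \<open>auto intro!: continuous_intros closed_Collect_le\<close>)
  moreover have "{z. cmod (z - a) \<le> r} \<union> {z. r \<le> cmod (z - a)} = UNIV" by auto
  ultimately show ?thesis by (simp add: disc_potential_def[abs_def])
qed

text \<open>
  A function with such a minorant at every point of an open set satisfies the local sub-mean
  value inequality there.  Real parts of holomorphic functions are used as the harmonic functions
  so that exponentiating gives the modulus of a holomorphic function.
\<close>
definition harmonic_support :: "(complex \<Rightarrow> real) \<Rightarrow> complex \<Rightarrow> bool" where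
  "harmonic_support h p \<longleftrightarrow>
     (\<exists>e>0. \<exists>g. g holomorphic_on ball p e \<and> Re (g p) = h p \<and> (\<forall>z\<in>ball p e. Re (g z) \<le> h z))"

lemma harmonic_support_add:
  assumes "harmonic_support h p" "harmonic_support k p"
  shows "harmonic_support (\<lambda>z. h z + k z) p"
proof -
  obtain e g where e: "e > 0" "g holomorphic_on ball p e" "Re (g p) = h p" "\<And>z. z \<in> ball p e \<Longrightarrow> Re (g z) \<le> h z"
    using assms(1) by (auto simp: harmonic_support_def)
  obtain e' g' where e': "e' > 0" "g' holomorphic_on ball p e'" "Re (g' p) = k p" "\<And>z. z \<in> ball p e' \<Longrightarrow> Re (g' z) \<le> k z"
    using assms(2) by (auto simp: harmonic_support_def)
  show ?thesis unfolding harmonic_support_def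
  proof (intro exI conjI ballI)
    show "min e e' > 0" using e e' by simp
    show "(\<lambda>z. g z + g' z) holomorphic_on ball p (min e e')"
      by (intro holomorphic_on_add holomorphic_on_subset[OF e(2)] holomorphic_on_subset[OF e'(2)]) auto
    show "Re (g p + g' p) = h p + k p" using e e' by simp
    show "Re (g z + g' z) \<le> h z + k z" if "z \<in> ball p (min e e')" for z
      using that e(4)[of z] e'(4)[of z] by simp
  qed
qed

lemma harmonic_support_const: "harmonic_support (\<lambda>_. c) p"
  unfolding harmonic_support_def
  by (intro exI[of _ 1] conjI exI[of _ "\<lambda>_. of_real c"]) auto

lemma harmonic_support_sum:
  assumes "\<And>i. i \<in> I \<Longrightarrow> harmonic_support (h i) p"
  shows "harmonic_support (\<lambda>z. \<Sum>i\<in>I. h i z) p"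
  using assms
  by (induction I rule: infinite_finite_induct)
     (simp_all add: harmonic_support_const harmonic_support_add)

lemma harmonic_supportI:
  assumes "e > 0" "g holomorphic_on ball p e" "Re (g p) = h p"
    and "\<And>z. z \<in> ball p e \<Longrightarrow> Re (g z) \<le> h z"
  shows "harmonic_support h p"
  using assms unfolding harmonic_support_def by blast

lemma harmonic_support_cmult:
  assumes "harmonic_support h p" "c \<ge> 0"
  shows "harmonic_support (\<lambda>z. c * h z) p"
proof -
  obtain e g where e: "e > 0" "g holomorphic_on ball p e" "Re (g p) = h p" "\<And>z. z \<in> ball p e \<Longrightarrow> Re (g z) \<le> h z"
    using assms(1) by (auto simp: harmonic_support_def)
  show ?thesis
    by (rule harmonic_supportI[OF e(1), of "\<lambda>z. of_real c * g z"])
       (use e assms(2) in \<open>auto intro!: holomorphic_intros mult_left_mono\<close>)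
qed

text \<open>
  A branch of the logarithm near \<open>p\<close>: the quotient \<open>(z - a) / (p - a)\<close> stays in the right
  half plane as long as \<open>z\<close> is closer to \<open>p\<close> than \<open>a\<close> is.
\<close>
lemma local_log_modulus:
  fixes c d :: real
  assumes "p \<noteq> a" "d > 0"
  obtains e g where "e > 0" "g holomorphic_on ball p e"
    "\<And>z. z \<in> ball p e \<Longrightarrow> z \<noteq> a \<and> Re (g z) = c * (1 + ln ((cmod (z - a))\<^sup>2 / d))"
proof -
  have e: "cmod (p - a) > 0" using assms by simp
  define g where "g z = of_real c * (1 + of_real (ln ((cmod (p - a))\<^sup>2 / d)) + 2 * Ln ((z - a) / (p - a)))" for z
  have dom: "Re ((z - a) / (p - a)) > 0" if "z \<in> ball p (cmod (p - a))" for z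
  proof -
    have "(z - a) / (p - a) = 1 + (z - p) / (p - a)" using assms by (simp add: field_simps)
    moreover have "cmod ((z - p) / (p - a)) < 1"
      using that e by (simp add: norm_divide dist_norm norm_minus_commute)
    ultimately show ?thesis using abs_Re_le_cmod[of "(z - p) / (p - a)"] by simp
  qed
  have "g holomorphic_on ball p (cmod (p - a))" unfolding g_def
    by (intro holomorphic_intros) (use assms dom in \<open>auto simp: complex_nonpos_Reals_iff dest: dom\<close>, smt (verit) dom mem_ball)
  moreover have "z \<noteq> a \<and> Re (g z) = c * (1 + ln ((cmod (z - a))\<^sup>2 / d))" if z: "z \<in> ball p (cmod (p - a))" for z
  proof -
    have za: "z \<noteq> a" using z by (auto simp: dist_norm)
    have "Re (g z) = c * (1 + ln ((cmod (p - a))\<^sup>2 / d) + 2 * ln (cmod ((z - a) / (p - a))))"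
      using za assms by (simp add: g_def)
    also have "\<dots> = c * (1 + ln ((cmod (z - a))\<^sup>2 / d))"
      using za assms by (simp add: norm_divide ln_div ln_realpow)
    finally show ?thesis using za by simp
  qed
  ultimately show thesis using e that by blast
qed

text \<open>
  Inside the disc the tangent plane of the convex function \<open>|z - a|^2\<close> is a minorant; on and
  outside the circle the logarithm is one, since it lies below the potential everywhere.
\<close>
lemma harmonic_support_disc_potential:
  assumes r: "r > 0"
  shows "harmonic_support (disc_potential a r) p"
proof (cases "cmod (p - a) < r")
  case True
  define g where "g z = 2 * cnj (p - a) * (z - p) + of_real ((cmod (p - a))\<^sup>2)" for z
  show ?thesis
  proof (rule harmonic_supportI)
    show "r - cmod (p - a) > 0" using True by simp
    show "g holomorphic_on ball p (r - cmod (p - a))" unfolding g_def by (intro holomorphic_intros)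
    show "Re (g p) = disc_potential a r p" using True by (simp add: g_def disc_potential_def)
    fix z assume "z \<in> ball p (r - cmod (p - a))"
    then have "cmod (z - a) \<le> r"
      using norm_triangle_ineq[of "z - p" "p - a"] by (simp add: dist_norm norm_minus_commute)
    moreover have "(cmod (z - a))\<^sup>2 = Re (g z) + (cmod (z - p))\<^sup>2"
      unfolding g_def by (simp add: cmod_power2) (simp add: power2_eq_square algebra_simps)
    ultimately show "Re (g z) \<le> disc_potential a r z" by (simp add: disc_potential_def)
  qed
next
  case False
  then have pa: "p \<noteq> a" using r by auto
  obtain e g where "e > 0" "g holomorphic_on ball p e"
    "\<And>z. z \<in> ball p e \<Longrightarrow> z \<noteq> a \<and> Re (g z) = r\<^sup>2 * (1 + ln ((cmod (z - a))\<^sup>2 / r\<^sup>2))"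
    using local_log_modulus[OF pa, of "r\<^sup>2" "r\<^sup>2"] r by (metis zero_less_power)
  then show ?thesis using False r
    by (intro harmonic_supportI[of e g]) (auto simp: disc_potential_outside disc_potential_ge)
qed

text \<open>
  The potential is harmonic off the closed disc, so there its negative is its own minorant.
\<close>
lemma harmonic_support_minus_disc_potential:
  assumes r: "r > 0" and p: "p \<notin> cball a r"
  shows "harmonic_support (\<lambda>z. - disc_potential a r z) p"
proof -
  have pa: "p \<noteq> a" using assms by auto
  obtain e g where e: "e > 0" "g holomorphic_on ball p e"
    "\<And>z. z \<in> ball p e \<Longrightarrow> z \<noteq> a \<and> Re (g z) = (- (r\<^sup>2)) * (1 + ln ((cmod (z - a))\<^sup>2 / r\<^sup>2))"
    using local_log_modulus[OF pa, of "r\<^sup>2" "- (r\<^sup>2)"] r by (metis zero_less_power)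
  define d where "d = min e (cmod (p - a) - r)"
  have pos: "disc_potential a r z = r\<^sup>2 * (1 + ln ((cmod (z - a))\<^sup>2 / r\<^sup>2))" if "z \<in> ball p d" for z
  proof (rule disc_potential_outside[OF r])
    show "r \<le> cmod (z - a)"
      using that norm_triangle_ineq[of "p - z" "z - a"] by (simp add: dist_norm d_def)
  qed
  have "d > 0" using e p by (simp add: d_def dist_norm norm_minus_commute)
  show ?thesis
  proof (rule harmonic_supportI)
    show "g holomorphic_on ball p d" by (rule holomorphic_on_subset[OF e(2)]) (auto simp: d_def)
    show "Re (g p) = - disc_potential a r p" using e(1) e(3)[of p] pos[of p] \<open>d > 0\<close> by simp
    show "Re (g z) \<le> - disc_potential a r z" if "z \<in> ball p d" for z
      using that e(3)[of z] pos[OF that] by (simp add: d_def)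
  qed fact
qed

text \<open>
  Where a disc covers \<open>p\<close>, its potential compensates any function that is dominated by some
  \<open>|z - c|^2\<close> with contact at \<open>p\<close>, because the difference of two squared distances is affine.
  This serves for the weight \<open>|z|^2\<close> and for the potential of a smaller disc containing \<open>p\<close>.
\<close>
lemma harmonic_support_disc_potential_minus:
  assumes p: "p \<in> ball a r"
    and k: "\<And>z. k z \<le> (cmod (z - c))\<^sup>2" "k p = (cmod (p - c))\<^sup>2"
  shows "harmonic_support (\<lambda>z. disc_potential a r z - k z) p"
proof (rule harmonic_supportI)
  define g where "g z = 2 * cnj (c - a) * z + of_real ((cmod a)\<^sup>2 - (cmod c)\<^sup>2)" for z
  have g: "Re (g z) = (cmod (z - a))\<^sup>2 - (cmod (z - c))\<^sup>2" for z
    unfolding g_def by (simp add: cmod_power2) (simp add: power2_eq_square algebra_simps)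
  show "r - cmod (p - a) > 0" using p by (simp add: dist_norm norm_minus_commute)
  show "g holomorphic_on ball p (r - cmod (p - a))" unfolding g_def by (intro holomorphic_intros)
  show "Re (g p) = disc_potential a r p - k p"
    using p by (simp add: g k disc_potential_def dist_norm norm_minus_commute)
  show "Re (g z) \<le> disc_potential a r z - k z" if "z \<in> ball p (r - cmod (p - a))" for z
  proof -
    have "cmod (z - a) \<le> r"
      using that norm_triangle_ineq[of "z - p" "p - a"] by (simp add: dist_norm norm_minus_commute)
    then show ?thesis using k(1)[of z] by (simp add: g disc_potential_def)
  qed
qed

text \<open>
  At a maximum point inside \<open>G\<close> the minorant of \<open>T\<close> gives a holomorphic function whose modulus
  is below \<open>|F| exp T\<close> and equal to it at the point.  By the maximum modulus principle it is
  constant, so all nearby points are maximum points as well.  Hence a maximum point of largest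
  modulus cannot lie in \<open>G\<close>.
\<close>
lemma harmonic_support_maximum_principle:
  assumes F: "F holomorphic_on UNIV" and T: "continuous_on UNIV T"
    and G: "open G" "bounded G"
    and supp: "\<And>p. p \<in> G \<Longrightarrow> harmonic_support T p"
    and z: "z \<in> G"
  obtains q where "q \<notin> G" "cmod (F z) * exp (T z) \<le> cmod (F q) * exp (T q)"
proof -
  define E where "E z = cmod (F z) * exp (T z)" for z
  have contE: "continuous_on A E" for A
    unfolding E_def using F T
    by (intro continuous_intros) (auto intro: holomorphic_on_imp_continuous_on continuous_on_subset holomorphic_on_subset)
  let ?K = "closure G"
  have K: "compact ?K" using G by (simp add: compact_closure)
  obtain x0 where x0: "x0 \<in> ?K" "\<And>y. y \<in> ?K \<Longrightarrow> E y \<le> E x0"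
    using continuous_attains_sup[OF K _ contE] z closure_subset by (metis empty_iff subsetD)
  define M where "M = {x \<in> ?K. E x = E x0}"
  have "M = ?K \<inter> E -` {E x0}" by (auto simp: M_def)
  then have cM: "compact M"
    using K by (metis compact_Int_closed closed_vimage closed_singleton contE)
  obtain q where q: "q \<in> M" "\<And>y. y \<in> M \<Longrightarrow> cmod y \<le> cmod q"
    using continuous_attains_sup[OF cM, of cmod] x0 by (auto simp: M_def continuous_on_norm_id)
  have "q \<notin> G"
  proof
    assume qG: "q \<in> G"
    obtain e g where e: "e > 0" "g holomorphic_on ball q e" "Re (g q) = T q" "\<And>z. z \<in> ball q e \<Longrightarrow> Re (g z) \<le> T z"
      using supp[OF qG] by (auto simp: harmonic_support_def)
    obtain e' where e': "e' > 0" "ball q e' \<subseteq> G" using G qG open_contains_ball by blast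
    define d where "d = min e e'"
    have d: "d > 0" "ball q d \<subseteq> G" "ball q d \<subseteq> ball q e" using e e' by (auto simp: d_def)
    define h where "h z = F z * exp (g z)" for z
    have hol: "h holomorphic_on ball q d" unfolding h_def
      by (intro holomorphic_intros holomorphic_on_subset[OF F] holomorphic_on_subset[OF e(2)]) (use d in auto)
    have hE: "cmod (h z) \<le> E z" if "z \<in> ball q d" for z
      unfolding h_def E_def norm_mult norm_exp_eq_Re
      by (intro mult_left_mono) (use e(4)[of z] that d in auto)
    have hq: "cmod (h q) = E q" by (simp add: h_def E_def norm_mult e)
    have Eq: "E q = E x0" using q by (simp add: M_def)
    have GK: "G \<subseteq> ?K" by (rule closure_subset)
    have "h constant_on ball q d"
    proof (rule maximum_modulus_principle[OF hol])
      fix z assume "z \<in> ball q d"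
      then have "cmod (h z) \<le> E z" "E z \<le> E x0" using hE x0 d GK by blast+
      then show "cmod (h z) \<le> cmod (h q)" by (simp add: hq Eq)
    qed (use d in auto)
    then have const: "h z = h q" if "z \<in> ball q d" for z
      using that d by (metis constant_on_def centre_in_ball)
    \<comment> \<open>a point near \<open>q\<close> of larger modulus; \<open>sgn q\<close> gives no direction when \<open>q = 0\<close>\<close>
    define y where "y = q + of_real (d / 2) * (if q = 0 then 1 else sgn q)"
    have y: "y \<in> ball q d" using d by (simp add: y_def dist_norm norm_mult norm_sgn)
    have "E x0 \<le> E y" using hE[OF y] const[OF y] hq Eq by simp
    then have "y \<in> M" using x0(2)[of y] y d GK by (force simp: M_def)
    then have "cmod y \<le> cmod q" by (rule q)
    moreover have "cmod y = cmod q + d / 2"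
    proof (cases "q = 0")
      case True then show ?thesis using d by (simp add: y_def)
    next
      case False
      have "y = of_real (cmod q + d / 2) * sgn q"
        using False by (simp add: y_def sgn_eq algebra_simps)
      then show ?thesis using False d by (simp add: norm_mult norm_sgn del: of_real_add)
    qed
    ultimately show False using d by simp
  qed
  moreover have "E z \<le> E q" using q x0(2)[of z] z closure_subset by (force simp: M_def)
  ultimately show thesis using that by (simp add: E_def)
qed

section \<open>Overlaps in coverings by large discs\<close>

text \<open>
  The sum of the three squared distances is at most \<open>9 s^2\<close>.  For unit vectors in the plane
  this says that two of them enclose an angle of at most 120 degrees.
\<close>
lemma two_of_three_close:
  fixes a b c :: "'a::real_inner"
  assumes "norm a \<le> s" "norm b \<le> s" "norm c \<le> s"
  shows "(norm (a - b))\<^sup>2 \<le> 3 * s\<^sup>2 \<or> (norm (b - c))\<^sup>2 \<le> 3 * s\<^sup>2 \<or> (norm (c - a))\<^sup>2 \<le> 3 * s\<^sup>2"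
proof -
  have "(norm a)\<^sup>2 \<le> s\<^sup>2" "(norm b)\<^sup>2 \<le> s\<^sup>2" "(norm c)\<^sup>2 \<le> s\<^sup>2"
    using assms by (simp_all add: power_mono)
  moreover have "(norm (a - b))\<^sup>2 + (norm (b - c))\<^sup>2 + (norm (c - a))\<^sup>2
      = 3 * ((norm a)\<^sup>2 + (norm b)\<^sup>2 + (norm c)\<^sup>2) - (norm (a + b + c))\<^sup>2"
    unfolding power2_norm_eq_inner by (simp add: inner_diff inner_add inner_commute algebra_simps)
  ultimately show ?thesis using zero_le_power2[of "norm (a + b + c)"] by (smt (verit))
qed

text \<open>
  The lens is at its thickest around the midpoint, where an inscribed disc has radius
  \<open>s - |a - b| / 2\<close>, and \<open>1 - sqrt 3 / 2 > 1 / 8\<close>.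
\<close>
lemma lens_contains_cball:
  fixes a b :: complex
  assumes "s > 0" "(cmod (a - b))\<^sup>2 \<le> 3 * s\<^sup>2"
  shows "cball ((a + b) / 2) (s / 8) \<subseteq> ball a s \<inter> ball b s"
proof -
  have "(cmod (a - b))\<^sup>2 \<le> (87 / 50 * s)\<^sup>2" using assms(2) by (simp add: power_mult_distrib power2_eq_square)
      (smt (verit) mult_nonneg_nonneg assms(1))
  then have d: "cmod (a - b) \<le> 87 / 50 * s" by (rule power2_le_imp_le) (use assms in simp)
  have "cmod (a - (a + b) / 2) = cmod (a - b) / 2" "cmod (b - (a + b) / 2) = cmod (a - b) / 2"
  proof -
    have "a - (a + b) / 2 = (a - b) / 2" "b - (a + b) / 2 = - ((a - b) / 2)" by (simp_all add: field_simps)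
    then show "cmod (a - (a + b) / 2) = cmod (a - b) / 2" "cmod (b - (a + b) / 2) = cmod (a - b) / 2"
      by (simp_all only: norm_minus_cancel norm_divide norm_numeral)
  qed
  then have "cmod (a - (a + b) / 2) + s / 8 < s" "cmod (b - (a + b) / 2) + s / 8 < s"
    using d assms(1) by linarith+
  then show ?thesis by (auto simp: cball_subset_ball_iff dist_norm norm_minus_commute)
qed

text \<open>
  Shrink the disc towards \<open>q\<close> by the factor \<open>s / r\<close>.
\<close>
lemma inscribed_disc_near_point:
  fixes q w :: complex
  assumes q: "q \<in> cball w r" and s: "0 < s" "s \<le> r"
  obtains a where "ball a s \<subseteq> ball w r" "cmod (a - q) \<le> s"
proof
  define a where "a = w + of_real (1 - s / r) * (q - w)"
  have qw: "cmod (q - w) \<le> r" using q by (simp add: dist_norm norm_minus_commute)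
  have f: "0 \<le> 1 - s / r" "0 \<le> s / r" using s by auto
  have "cmod (a - w) = (1 - s / r) * cmod (q - w)" using f by (simp add: a_def norm_mult del: of_real_diff)
  also have "\<dots> \<le> (1 - s / r) * r" using qw f by (intro mult_left_mono)
  also have "\<dots> = r - s" using s by (simp add: field_simps)
  finally show "ball a s \<subseteq> ball w r"
    by (simp add: ball_subset_ball_iff dist_norm)
  have "a - q = of_real (s / r) * (w - q)" using s by (simp add: a_def field_simps)
  then have "cmod (a - q) = s / r * cmod (q - w)" using f
    by (simp only: norm_mult norm_of_real norm_minus_commute[of w q] abs_of_nonneg)
  also have "\<dots> \<le> s / r * r" using qw f by (intro mult_left_mono)
  also have "\<dots> = s" using s by simp
  finally show "cmod (a - q) \<le> s" .
qed

text \<open>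
  Look at the half circle of the disc around \<open>w0\<close> that faces away from the origin; it lies
  outside \<open>D(0, R)\<close> and is covered by the other discs.  If some point of it lies in two of them,
  three discs have this point in their closures.  Otherwise connectedness puts the half circle
  into a single other disc, which by convexity contains \<open>w0\<close>.  In both cases two of the
  discs contain discs of radius \<open>s\<close> with centres at distance at most \<open>sqrt 3 * s\<close>.
\<close>
lemma disc_cover_overlap:
  fixes \<Lambda> :: "complex set" and r :: "complex \<Rightarrow> real"
  assumes s: "s > 0" "\<And>w. w \<in> \<Lambda> \<Longrightarrow> s \<le> r w"
    and cover: "\<And>z. cmod z > R \<Longrightarrow> \<exists>w\<in>\<Lambda>. z \<in> ball w (r w)"
    and far: "w0 \<in> \<Lambda>" "cmod w0 > R" and R: "R \<ge> 0"
  obtains c w w' where "w \<in> \<Lambda>" "w' \<in> \<Lambda>" "w \<noteq> w'"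
    "cball c (s / 8) \<subseteq> ball w (r w) \<inter> ball w' (r w')" "cmod c > R - s"
proof -
  note found = that
  \<comment> \<open>it suffices to find, near a far point \<open>q\<close>, two close discs of radius \<open>s\<close> inside different discs of the covering\<close>
  have fin: thesis
    if "w \<in> \<Lambda>" "w' \<in> \<Lambda>" "w \<noteq> w'" "ball a s \<subseteq> ball w (r w)" "ball b s \<subseteq> ball w' (r w')"
      "cmod (a - q) \<le> s" "cmod (b - q) \<le> s" "(cmod (a - b))\<^sup>2 \<le> 3 * s\<^sup>2" "cmod q > R" for w w' a b q
  proof (rule found)
    show "cball ((a + b) / 2) (s / 8) \<subseteq> ball w (r w) \<inter> ball w' (r w')"
      using lens_contains_cball[OF s(1) \<open>(cmod (a - b))\<^sup>2 \<le> 3 * s\<^sup>2\<close>] \<open>ball a s \<subseteq> _\<close> \<open>ball b s \<subseteq> _\<close> by blast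
    have "(a + b) / 2 - q = ((a - q) + (b - q)) / 2" by (simp add: field_simps)
    then have "cmod ((a + b) / 2 - q) = cmod ((a - q) + (b - q)) / 2" by (simp only: norm_divide norm_numeral)
    also have "\<dots> \<le> s" using norm_triangle_ineq[of "a - q" "b - q"] \<open>cmod (a - q) \<le> s\<close> \<open>cmod (b - q) \<le> s\<close> by simp
    finally show "cmod ((a + b) / 2) > R - s"
      using norm_triangle_ineq2[of q "(a + b) / 2"] \<open>cmod q > R\<close> by (simp add: norm_minus_commute)
  qed (use that in auto)
  define u where "u = sgn w0"
  have w0: "w0 \<noteq> 0" "w0 = of_real (cmod w0) * u" "cmod u = 1"
    using far R by (auto simp: u_def norm_sgn) (auto simp: sgn_eq)
  have r0: "r w0 > 0" using s far by force
  define h where "h t = w0 + of_real (r w0) * u * cis t" for t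
  define H where "H = h ` {-(pi/2)..pi/2}"
  have Hfar: "cmod q > R" "cmod (q - w0) = r w0" if qH: "q \<in> H" for q
  proof -
    obtain t where "t \<in> {-(pi/2)..pi/2}" "q = h t" using qH unfolding H_def by blast
    then have t: "- (pi/2) \<le> t" "t \<le> pi/2" "q = h t" by simp_all
    have "q = of_real (cmod w0) * u + of_real (r w0) * u * cis t"
      unfolding t(3) h_def by (subst w0(2)[symmetric]) (rule refl)
    then have "q = u * (of_real (cmod w0) + of_real (r w0) * cis t)"
      by (simp only: distrib_left mult_ac)
    then have "cmod q = cmod (of_real (cmod w0) + of_real (r w0) * cis t)" by (simp add: norm_mult w0(3))
    also have "\<dots> \<ge> Re (of_real (cmod w0) + of_real (r w0) * cis t)" by (rule complex_Re_le_cmod)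
    also have "Re (of_real (cmod w0) + of_real (r w0) * cis t) = cmod w0 + r w0 * cos t" by simp
    finally have "cmod w0 + r w0 * cos t \<le> cmod q" .
    moreover have "r w0 * cos t \<ge> 0" using t r0 cos_ge_zero[of t] by simp
    ultimately show "cmod q > R" using far by linarith
    show "cmod (q - w0) = r w0" using r0 w0(3) by (simp add: t(3) h_def norm_mult)
  qed
  have Hcov: "\<exists>w\<in>\<Lambda>. w \<noteq> w0 \<and> q \<in> ball w (r w)" if "q \<in> H" for q
    using cover[OF Hfar(1)[OF that]] Hfar(2)[OF that] by (metis dist_norm mem_ball norm_minus_commute less_irrefl)
  show thesis
  proof (cases "\<exists>q\<in>H. \<exists>w\<in>\<Lambda>. \<exists>w'\<in>\<Lambda>. w \<noteq> w0 \<and> w' \<noteq> w0 \<and> w \<noteq> w' \<and> q \<in> ball w (r w) \<and> q \<in> ball w' (r w')")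
    case True
    then obtain q w w' where q: "q \<in> H" "w \<in> \<Lambda>" "w' \<in> \<Lambda>" "w \<noteq> w0" "w' \<noteq> w0" "w \<noteq> w'" "q \<in> ball w (r w)" "q \<in> ball w' (r w')"
      by blast
    have cb: "q \<in> cball w (r w)" "q \<in> cball w' (r w')" "q \<in> cball w0 (r w0)"
      using q Hfar(2)[of q] by (auto simp: dist_norm norm_minus_commute)
    obtain a where a: "ball a s \<subseteq> ball w (r w)" "cmod (a - q) \<le> s"
      using inscribed_disc_near_point[OF cb(1) s(1) s(2)[OF q(2)]] .
    obtain b where b: "ball b s \<subseteq> ball w' (r w')" "cmod (b - q) \<le> s"
      using inscribed_disc_near_point[OF cb(2) s(1) s(2)[OF q(3)]] .
    obtain c where c: "ball c s \<subseteq> ball w0 (r w0)" "cmod (c - q) \<le> s"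
      using inscribed_disc_near_point[OF cb(3) s(1) s(2)[OF far(1)]] .
    note abc = a b c
    have "(cmod (a - b))\<^sup>2 \<le> 3 * s\<^sup>2 \<or> (cmod (b - c))\<^sup>2 \<le> 3 * s\<^sup>2 \<or> (cmod (c - a))\<^sup>2 \<le> 3 * s\<^sup>2"
      using two_of_three_close[OF abc(2,4,6)] by simp
    then show thesis
    proof (elim disjE)
      assume "(cmod (a - b))\<^sup>2 \<le> 3 * s\<^sup>2"
      then show thesis by (rule fin[OF q(2,3,6) abc(1,3,2,4) _ Hfar(1)[OF q(1)]])
    next
      assume "(cmod (b - c))\<^sup>2 \<le> 3 * s\<^sup>2"
      then show thesis by (rule fin[OF q(3) far(1) q(5) abc(3,5,4,6) _ Hfar(1)[OF q(1)]])
    next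
      assume "(cmod (c - a))\<^sup>2 \<le> 3 * s\<^sup>2"
      then show thesis by (rule fin[OF far(1) q(2) q(4)[symmetric] abc(5,1,6,2) _ Hfar(1)[OF q(1)]])
    qed
  next
    case False
    have ends: "h (pi/2) \<in> H" "h (-(pi/2)) \<in> H" by (auto simp: H_def)
    obtain w where w: "w \<in> \<Lambda>" "w \<noteq> w0" "h (pi/2) \<in> ball w (r w)" using Hcov ends by blast
    define B where "B = (\<Union>v\<in>\<Lambda> - {w0, w}. ball v (r v))"
    have conn: "connected H" unfolding H_def h_def
      by (intro connected_continuous_image continuous_intros) auto
    have opens: "open (ball w (r w))" "open B" by (auto simp: B_def)
    have HB: "H \<subseteq> ball w (r w) \<union> B"
    proof
      fix q assume "q \<in> H"
      then obtain v where "v \<in> \<Lambda>" "v \<noteq> w0" "q \<in> ball v (r v)" using Hcov by blast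
      then show "q \<in> ball w (r w) \<union> B" unfolding B_def by blast
    qed
    have "ball w (r w) \<inter> B \<inter> H = {}" using False w(1,2) unfolding B_def by blast
    then have "B \<inter> H = {}" using connectedD[OF conn opens _ HB] w(3) ends(1) by blast
    then have "h (-(pi/2)) \<in> ball w (r w)" using HB ends(2) by blast
    with w(3) have "closed_segment (h (pi/2)) (h (-(pi/2))) \<subseteq> ball w (r w)"
      by (simp add: closed_segment_subset)
    moreover have "w0 = midpoint (h (pi/2)) (h (-(pi/2)))"
      by (simp add: h_def midpoint_def complex_eq_iff)
    ultimately have "w0 \<in> ball w (r w)" using midpoint_in_closed_segment by blast
    then obtain b where b: "ball b s \<subseteq> ball w (r w)" "cmod (b - w0) \<le> s"
      using inscribed_disc_near_point[of w0 w "r w" s] s w by auto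
    have "(cmod (w0 - b))\<^sup>2 \<le> s\<^sup>2" using b by (intro power_mono) (auto simp: norm_minus_commute)
    then have "(cmod (w0 - b))\<^sup>2 \<le> 3 * s\<^sup>2" using zero_le_power2[of s] by linarith
    moreover have "ball w0 s \<subseteq> ball w0 (r w0)" using s(2)[OF far(1)] by (rule subset_ball)
    ultimately show thesis using w(2) s(1) b by (intro fin[of w0 w w0 b w0]) (use far w(1) in auto)
  qed
qed

lemma separated_finite_subset:
  fixes P :: "'a::real_normed_vector \<Rightarrow> bool"
  assumes "\<And>R. \<exists>c. P c \<and> norm c > R"
  shows "\<exists>C. finite C \<and> card C = N \<and> (\<forall>c\<in>C. P c) \<and> pairwise (\<lambda>c c'. dist c c' > d) C"
proof (induction N)
  case 0 show ?case by (intro exI[of _ "{}"]) auto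
next
  case (Suc N)
  then obtain C where C: "finite C" "card C = N" "\<forall>c\<in>C. P c" "pairwise (\<lambda>c c'. dist c c' > d) C" by blast
  obtain c where c: "P c" "norm c > \<bar>d\<bar> + (\<Sum>x\<in>C. norm x)" using assms by blast
  have le: "norm x \<le> (\<Sum>x\<in>C. norm x)" if "x \<in> C" for x
    using that C(1) by (intro member_le_sum) auto
  have far: "dist c x > d" if "x \<in> C" for x
    using le[OF that] c(2) norm_triangle_ineq2[of c x] by (simp add: dist_norm)
  have "c \<notin> C" using le[of c] c(2) by force
  then show ?case using C c far
    by (intro exI[of _ "insert c C"]) (auto simp: pairwise_insert dist_commute)
qed

section \<open>Dividing out zeros\<close>

text \<open>
  The quotient is holomorphic off \<open>w\<close>, and the local factor \<open>g\<close> fills in the missing point.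
\<close>
lemma entire_divide_zero:
  fixes f :: "complex \<Rightarrow> complex"
  assumes f: "f holomorphic_on UNIV" and e: "e > 0" and g: "g holomorphic_on ball w e"
    and fg: "\<And>z. z \<in> ball w e \<Longrightarrow> f z = g z * (z - w) ^ n"
  obtains F where "F holomorphic_on UNIV" "\<And>z. f z = F z * (z - w) ^ n"
proof
  define F where "F z = (if z = w then g w else f z / (z - w) ^ n)" for z
  have Fg: "F z = g z" if "z \<in> ball w e" for z using fg[OF that] by (auto simp: F_def)
  have "F holomorphic_on ball w e" using g by (rule holomorphic_transform) (simp add: Fg)
  moreover have "(\<lambda>z. f z / (z - w) ^ n) holomorphic_on (- {w})"
    by (intro holomorphic_intros holomorphic_on_subset[OF f]) auto
  then have "F holomorphic_on (- {w})" by (rule holomorphic_transform) (auto simp: F_def)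
  ultimately have "F holomorphic_on (ball w e \<union> - {w})" by (rule holomorphic_on_Un) auto
  moreover have "ball w e \<union> - {w} = UNIV" using e by auto
  ultimately show "F holomorphic_on UNIV" by simp
  show "f z = F z * (z - w) ^ n" for z using fg[of w] Fg[of w] e by (cases "z = w") (auto simp: F_def)
qed

lemma entire_divide_zeros:
  fixes f :: "complex \<Rightarrow> complex"
  assumes "finite S" "f holomorphic_on UNIV"
    and "\<And>w. w \<in> S \<Longrightarrow> \<exists>e>0. \<exists>g. g holomorphic_on ball w e \<and> (\<forall>z\<in>ball w e. f z = g z * (z - w) ^ m w)"
  shows "\<exists>F. F holomorphic_on UNIV \<and> (\<forall>z. f z = F z * (\<Prod>w\<in>S. (z - w) ^ m w))"
  using assms
proof (induction S arbitrary: f rule: finite_induct)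
  case empty then show ?case by auto
next
  case (insert v S)
  obtain F where F: "F holomorphic_on UNIV" "\<And>z. f z = F z * (z - v) ^ m v"
    using insert.prems(2)[of v] entire_divide_zero[OF insert.prems(1)] by (metis insertI1)
  have "\<exists>e>0. \<exists>g. g holomorphic_on ball w e \<and> (\<forall>z\<in>ball w e. F z = g z * (z - w) ^ m w)" if w: "w \<in> S" for w
  proof -
    obtain e g where e: "e > 0" "g holomorphic_on ball w e" "\<forall>z\<in>ball w e. f z = g z * (z - w) ^ m w"
      using insert.prems(2)[of w] w by blast
    define d where "d = min e (cmod (v - w))"
    have wv: "w \<noteq> v" using w insert.hyps by blast
    have nv: "z \<noteq> v" if "z \<in> ball w d" for z using that by (auto simp: d_def dist_norm norm_minus_commute)
    have "(\<lambda>z. g z / (z - v) ^ m v) holomorphic_on ball w d"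
      by (intro holomorphic_intros holomorphic_on_subset[OF e(2)]) (use nv in \<open>auto simp: d_def\<close>)
    moreover have "F z = g z / (z - v) ^ m v * (z - w) ^ m w" if "z \<in> ball w d" for z
    proof -
      have "F z * (z - v) ^ m v = g z * (z - w) ^ m w" using F(2)[of z] e(3) that by (auto simp: d_def)
      then show ?thesis using nv[OF that] by (simp add: field_simps)
    qed
    moreover have "d > 0" using e wv by (simp add: d_def)
    ultimately show ?thesis by blast
  qed
  then obtain F' where "F' holomorphic_on UNIV" "\<forall>z. F z = F' z * (\<Prod>w\<in>S. (z - w) ^ m w)"
    using insert.IH[OF F(1)] by blast
  then show ?case using F(2) insert.hyps by (intro exI[of _ F']) (auto simp: mult_ac)
qed

section \<open>Balancing the covering discs\<close>

text \<open>
  The weight \<open>|z|^2\<close> uses up one disc covering \<open>p\<close>.  By separation at most one of the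
  subtracted discs contains \<open>p\<close>, and then a second covering disc compensates it.  The remaining
  terms have minorants on their own.
\<close>
lemma harmonic_support_balanced_discs:
  fixes a :: "'i \<Rightarrow> complex"
  assumes I: "finite I" "\<And>i. i \<in> I \<Longrightarrow> r i > 0" and C: "finite C" and \<rho>: "\<rho> > 0"
    and covered: "\<exists>i\<in>I. p \<in> ball (a i) (r i)"
    and twice: "\<And>c. c \<in> C \<Longrightarrow> \<exists>i\<in>I. \<exists>j\<in>I. i \<noteq> j \<and> cball c \<rho> \<subseteq> ball (a i) (r i) \<inter> ball (a j) (r j)"
    and sep: "pairwise (\<lambda>c c'. dist c c' > 2 * \<rho>) C"
  shows "harmonic_support (\<lambda>z. (\<Sum>i\<in>I. disc_potential (a i) (r i) z)
           - (\<Sum>c\<in>C. disc_potential c \<rho> z) - (cmod z)\<^sup>2) p"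
proof -
  have rest: "harmonic_support (\<lambda>z. \<Sum>i\<in>J. disc_potential (a i) (r i) z) p" if "J \<subseteq> I" for J
    using that I by (intro harmonic_support_sum harmonic_support_disc_potential) auto
  have neg: "harmonic_support (\<lambda>z. \<Sum>c\<in>D. - disc_potential c \<rho> z) p" if "\<And>c. c \<in> D \<Longrightarrow> p \<notin> cball c \<rho>" for D
    using that \<rho> by (intro harmonic_support_sum harmonic_support_minus_disc_potential) auto
  have sq: "harmonic_support (\<lambda>z. disc_potential (a i) (r i) z - (cmod z)\<^sup>2) p" if "p \<in> ball (a i) (r i)" for i
    using harmonic_support_disc_potential_minus[OF that, of "\<lambda>z. (cmod z)\<^sup>2" 0] by simp
  show ?thesis
  proof (cases "\<exists>c\<in>C. p \<in> cball c \<rho>")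
    case True
    then obtain c where c: "c \<in> C" "p \<in> cball c \<rho>" by blast
    obtain i j where ij: "i \<in> I" "j \<in> I" "i \<noteq> j" "p \<in> ball (a i) (r i)" "p \<in> ball (a j) (r j)"
      using twice[OF c(1)] c(2) by blast
    have "p \<notin> cball c' \<rho>" if "c' \<in> C - {c}" for c'
    proof
      assume "p \<in> cball c' \<rho>"
      then have "dist c c' \<le> 2 * \<rho>" using c(2) dist_triangle[of c c' p] by (simp add: dist_commute)
      then show False using sep that c(1) by (fastforce simp: pairwise_def)
    qed
    then have D: "harmonic_support (\<lambda>z. \<Sum>c\<in>C - {c}. - disc_potential c \<rho> z) p" by (rule neg)
    have "harmonic_support (\<lambda>z. disc_potential (a j) (r j) z - disc_potential c \<rho> z) p"
      using c(2) \<rho>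
      by (intro harmonic_support_disc_potential_minus[OF ij(5), of _ c] disc_potential_le)
         (auto simp: disc_potential_def dist_norm norm_minus_commute)
    from harmonic_support_add[OF harmonic_support_add[OF sq[OF ij(4)] this] harmonic_support_add[OF rest[of "I - {i} - {j}"] D]]
    have "harmonic_support (\<lambda>z. disc_potential (a i) (r i) z - (cmod z)\<^sup>2 + (disc_potential (a j) (r j) z - disc_potential c \<rho> z) +
       ((\<Sum>i\<in>I - {i} - {j}. disc_potential (a i) (r i) z) + (\<Sum>c\<in>C - {c}. - disc_potential c \<rho> z))) p" by auto
    moreover have "(\<Sum>i\<in>I. disc_potential (a i) (r i) z) = disc_potential (a i) (r i) z + (disc_potential (a j) (r j) z + (\<Sum>i\<in>I - {i} - {j}. disc_potential (a i) (r i) z))" for z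
      using I(1) ij by (simp add: sum.remove[of I i] sum.remove[of "I - {i}" j])
    moreover have "(\<Sum>c\<in>C. disc_potential c \<rho> z) = disc_potential c \<rho> z + (\<Sum>c\<in>C - {c}. disc_potential c \<rho> z)" for z
      using C c(1) by (simp add: sum.remove)
    ultimately show ?thesis by (simp add: sum_negf algebra_simps)
  next
    case False
    obtain i where i: "i \<in> I" "p \<in> ball (a i) (r i)" using covered by blast
    have "harmonic_support (\<lambda>z. disc_potential (a i) (r i) z - (cmod z)\<^sup>2 +
       ((\<Sum>i\<in>I - {i}. disc_potential (a i) (r i) z) + (\<Sum>c\<in>C. - disc_potential c \<rho> z))) p"
      using False by (intro harmonic_support_add sq i rest neg) auto
    moreover have "(\<Sum>i\<in>I. disc_potential (a i) (r i) z) = disc_potential (a i) (r i) z + (\<Sum>i\<in>I - {i}. disc_potential (a i) (r i) z)" for z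
      using I(1) i by (simp add: sum.remove)
    ultimately show ?thesis by (simp add: sum_negf algebra_simps)
  qed
qed

text \<open>
  Near infinity the difference is \<open>(R0^2 - card C * \<rho>^2) * ln (|z|^2)\<close> up to a bounded term.
\<close>
lemma disc_potential_diff_small_near_infinity:
  assumes R0: "R0 > 0" and \<rho>: "\<rho> > 0" and C: "finite C" and area: "real (card C) * \<rho>\<^sup>2 > R0\<^sup>2"
  obtains R where "\<And>z. cmod z > R \<Longrightarrow> disc_potential 0 R0 z - (\<Sum>c\<in>C. disc_potential c \<rho> z) \<le> M"
proof -
  define \<delta> where "\<delta> = real (card C) * \<rho>\<^sup>2 - R0\<^sup>2"
  define A where "A = R0\<^sup>2 * (1 - ln (R0\<^sup>2)) - real (card C) * (\<rho>\<^sup>2 * (1 - ln (4 * \<rho>\<^sup>2)))"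
  define R where "R = max (max 1 R0) (max (2 * (\<Sum>c\<in>C. cmod c)) (exp ((A - M) / \<delta>)))"
  have \<delta>: "\<delta> > 0" using area by (simp add: \<delta>_def)
  show thesis
  proof
    fix z assume "cmod z > R"
    then have z: "cmod z > 1" "cmod z > R0" "cmod z > 2 * (\<Sum>c\<in>C. cmod c)" "cmod z > exp ((A - M) / \<delta>)"
      by (simp_all add: R_def)
    define L where "L = ln ((cmod z)\<^sup>2)"
    have z2: "(cmod z)\<^sup>2 > 0" by (rule zero_less_power) (use z(1) in linarith)
    have "exp ((A - M) / \<delta>) \<le> (cmod z)\<^sup>2" using z power_increasing[of 1 2 "cmod z"] by simp
    then have "(A - M) / \<delta> \<le> L" using z2 by (simp add: L_def ln_ge_iff)
    then have L: "A - \<delta> * L \<le> M" using \<delta> by (simp add: field_simps)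
    have P0: "disc_potential 0 R0 z = R0\<^sup>2 * (1 - ln (R0\<^sup>2)) + R0\<^sup>2 * L"
      using disc_potential_outside[OF R0, of z 0] z R0 z2 by (simp add: ln_div L_def algebra_simps)
    have Pc: "\<rho>\<^sup>2 * (1 - ln (4 * \<rho>\<^sup>2)) + \<rho>\<^sup>2 * L \<le> disc_potential c \<rho> z" if "c \<in> C" for c
    proof -
      have "cmod c \<le> (\<Sum>c\<in>C. cmod c)" using that C by (intro member_le_sum) auto
      then have zc: "cmod (z - c) \<ge> cmod z / 2" using z(3) norm_triangle_ineq2[of z c] by linarith
      have "(cmod z / 2)\<^sup>2 \<le> (cmod (z - c))\<^sup>2" using zc by (intro power_mono) auto
      then have le: "(cmod z)\<^sup>2 / (4 * \<rho>\<^sup>2) \<le> (cmod (z - c))\<^sup>2 / \<rho>\<^sup>2" using \<rho> by (simp add: field_simps)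
      have "z \<noteq> c" using zc z(1) by auto
      have "L - ln (4 * \<rho>\<^sup>2) = ln ((cmod z)\<^sup>2 / (4 * \<rho>\<^sup>2))" using z2 \<rho> by (simp add: L_def ln_div)
      also have "\<dots> \<le> ln ((cmod (z - c))\<^sup>2 / \<rho>\<^sup>2)" using le z2 \<rho> by (intro ln_mono) auto
      finally have "\<rho>\<^sup>2 * (1 + (L - ln (4 * \<rho>\<^sup>2))) \<le> \<rho>\<^sup>2 * (1 + ln ((cmod (z - c))\<^sup>2 / \<rho>\<^sup>2))"
        by (intro mult_left_mono) auto
      then show ?thesis using disc_potential_ge[OF \<rho> \<open>z \<noteq> c\<close>] by (simp add: algebra_simps)
    qed
    have "real (card C) * (\<rho>\<^sup>2 * (1 - ln (4 * \<rho>\<^sup>2)) + \<rho>\<^sup>2 * L) \<le> (\<Sum>c\<in>C. disc_potential c \<rho> z)"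
      using sum_bounded_below[of C "\<rho>\<^sup>2 * (1 - ln (4 * \<rho>\<^sup>2)) + \<rho>\<^sup>2 * L" "\<lambda>c. disc_potential c \<rho> z"] Pc by simp
    then have "disc_potential 0 R0 z - (\<Sum>c\<in>C. disc_potential c \<rho> z) \<le> A - \<delta> * L"
      unfolding P0 A_def \<delta>_def by (simp add: algebra_simps)
    then show "disc_potential 0 R0 z - (\<Sum>c\<in>C. disc_potential c \<rho> z) \<le> M" using L by linarith
  qed
qed

text \<open>
  When \<open>\<alpha> * r^2\<close> is the multiplicity, the exponential of the potential is a constant multiple
  of \<open>|z - w| ^ (2 * n)\<close> off the disc: there it exactly restores a zero of order \<open>n\<close> that has been
  divided out.
\<close>
lemma exp_disc_potential:
  assumes r: "r > 0" and m: "\<alpha> * r\<^sup>2 = real n" "n > 0" and \<alpha>: "\<alpha> > 0"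
  shows exp_disc_potential_ge: "(exp 1 / r\<^sup>2) ^ n * ((cmod (z - w))\<^sup>2) ^ n \<le> exp (\<alpha> * disc_potential w r z)"
    and exp_disc_potential_outside: "r \<le> cmod (z - w) \<Longrightarrow> exp (\<alpha> * disc_potential w r z) = (exp 1 / r\<^sup>2) ^ n * ((cmod (z - w))\<^sup>2) ^ n"
proof -
  have eq: "exp (\<alpha> * (r\<^sup>2 * (1 + ln ((cmod (z - w))\<^sup>2 / r\<^sup>2)))) = (exp 1 / r\<^sup>2) ^ n * ((cmod (z - w))\<^sup>2) ^ n"
    if "z \<noteq> w"
  proof -
    have x: "(cmod (z - w))\<^sup>2 / r\<^sup>2 > 0" using that r by simp
    have "\<alpha> * (r\<^sup>2 * (1 + ln ((cmod (z - w))\<^sup>2 / r\<^sup>2))) = real n * (1 + ln ((cmod (z - w))\<^sup>2 / r\<^sup>2))"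
      by (simp add: m(1)[symmetric] mult.assoc)
    also have "exp \<dots> = exp (1 + ln ((cmod (z - w))\<^sup>2 / r\<^sup>2)) ^ n" by (rule exp_of_nat_mult)
    also have "\<dots> = (exp 1 * ((cmod (z - w))\<^sup>2 / r\<^sup>2)) ^ n" using x by (simp only: exp_add exp_ln)
    also have "\<dots> = (exp 1 / r\<^sup>2) ^ n * ((cmod (z - w))\<^sup>2) ^ n" by (simp add: power_mult_distrib power_divide)
    finally show ?thesis .
  qed
  show "(exp 1 / r\<^sup>2) ^ n * ((cmod (z - w))\<^sup>2) ^ n \<le> exp (\<alpha> * disc_potential w r z)"
  proof (cases "z = w")
    case True then show ?thesis using m(2) by (simp add: power_0_left)
  next
    case False
    then show ?thesis using disc_potential_ge[OF r False] \<alpha> by (simp add: eq[OF False, symmetric])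
  qed
  show "exp (\<alpha> * disc_potential w r z) = (exp 1 / r\<^sup>2) ^ n * ((cmod (z - w))\<^sup>2) ^ n" if "r \<le> cmod (z - w)"
  proof -
    have "z \<noteq> w" using that r by auto
    then show ?thesis by (simp add: disc_potential_outside[OF r that] eq)
  qed
qed

section \<open>The theorem\<close>

theorem proposition4:
  fixes \<alpha> :: real and \<Lambda> :: "complex set" and m :: "complex \<Rightarrow> nat"
  assumes "\<alpha> > 0"
    and "divisor \<Lambda> m"
    and "\<exists>K. compact K \<and> (\<Union>w\<in>\<Lambda>. ball w (sqrt (real (m w) / \<alpha>))) = UNIV - K"
  shows "\<not> zero_divisor_Fock \<alpha> \<Lambda> m"
proof
  assume "zero_divisor_Fock \<alpha> \<Lambda> m"
  then obtain f where fock: "f \<in> Fock_space \<alpha>" and "f \<noteq> (\<lambda>_. 0)" and zeros: "{z. f z = 0} = \<Lambda>"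
    and ord: "\<And>w. w \<in> \<Lambda> \<Longrightarrow> zorder f w = int (m w)"
    unfolding zero_divisor_Fock_def by blast
  then obtain z1 where z1: "f z1 \<noteq> 0" by auto
  note \<alpha> = \<open>\<alpha> > 0\<close>
  have f: "f holomorphic_on UNIV" using fock by (simp add: Fock_space_def)
  have mpos: "m w > 0" if "w \<in> \<Lambda>" for w using assms(2) that by (simp add: divisor_def)
  define r where "r w = sqrt (real (m w) / \<alpha>)" for w
  define s where "s = sqrt (1 / \<alpha>)"
  define \<rho> where "\<rho> = s / 8"
  have s: "s > 0" and sr: "\<And>w. w \<in> \<Lambda> \<Longrightarrow> s \<le> r w" and \<rho>: "\<rho> > 0"
    using \<alpha> mpos by (auto simp: s_def r_def \<rho>_def divide_right_mono Suc_leI)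
  have rpos: "r w > 0" if "w \<in> \<Lambda>" for w using sr[OF that] s by linarith
  have \<alpha>r: "\<alpha> * (r w)\<^sup>2 = real (m w)" for w using \<alpha> by (simp add: r_def)
  obtain K where K: "compact K" "(\<Union>w\<in>\<Lambda>. ball w (r w)) = UNIV - K" using assms(3) unfolding r_def by blast
  obtain R0 where R0: "R0 > 0" "K \<subseteq> ball 0 R0"
    using K(1) by (meson bounded_subset_ballD compact_imp_bounded)
  have cover: "\<exists>w\<in>\<Lambda>. z \<in> ball w (r w)" if "z \<notin> ball 0 R0" for z
    using that K(2) R0(2) by blast
  have factor: "\<exists>e>0. \<exists>g. g holomorphic_on ball w e \<and> (\<forall>z\<in>ball w e. f z = g z * (z - w) ^ m w)" if "w \<in> \<Lambda>" for w
  proof -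
    obtain e where "e > 0" "zor_poly f w holomorphic_on cball w e"
       "\<forall>z\<in>cball w e. f z = zor_poly f w z * (z - w) ^ nat (zorder f w)"
      using zorder_exist_zero[of f UNIV w] f z1 by auto
    then show ?thesis
      by (intro exI[of _ e] conjI exI[of _ "zor_poly f w"]) (auto simp: ord[OF that] intro: holomorphic_on_subset)
  qed
  have unbounded: "\<exists>w\<in>\<Lambda>. cmod w > R" for R
  proof (rule ccontr)
    assume "\<not> ?thesis"
    then have "\<Lambda> = {z \<in> cball 0 R. f z = 0}" using zeros by (force simp: not_less)
    moreover have "finite {z \<in> cball 0 R. f z = 0}" if "\<Lambda> \<noteq> {}"
    proof (rule holomorphic_compact_finite_zeros[OF f])
      obtain w where "f w = 0" using \<open>\<Lambda> \<noteq> {}\<close> zeros by blast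
      then show "\<not> f constant_on UNIV" using z1 by (metis UNIV_I constant_on_def)
    qed auto
    ultimately have "finite \<Lambda>" by (cases "\<Lambda> = {}") auto
    then have "bounded ((\<Union>w\<in>\<Lambda>. ball w (r w)) \<union> K)" using K(1) compact_imp_bounded by auto
    then have "bounded (UNIV :: complex set)" unfolding K(2) by simp
    then show False by simp
  qed
  \<comment> \<open>centres of overlap discs; they occur arbitrarily far out, so any number of them can be separated\<close>
  define P where "P c \<longleftrightarrow> (\<exists>w\<in>\<Lambda>. \<exists>w'\<in>\<Lambda>. w \<noteq> w' \<and> cball c \<rho> \<subseteq> ball w (r w) \<inter> ball w' (r w'))" for c
  have "\<exists>c. P c \<and> cmod c > R" for R
  proof -
    obtain w0 where w0: "w0 \<in> \<Lambda>" "cmod w0 > max (R + s) R0" using unbounded by blast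
    obtain c w w' where "w \<in> \<Lambda>" "w' \<in> \<Lambda>" "w \<noteq> w'" "cball c (s / 8) \<subseteq> ball w (r w) \<inter> ball w' (r w')"
       "cmod c > max (R + s) R0 - s"
      by (rule disc_cover_overlap[of s \<Lambda> r "max (R + s) R0" w0]) (use s sr cover w0 R0 in auto)
    then show ?thesis unfolding P_def \<rho>_def by (intro exI[of _ c]) auto
  qed
  then obtain C where C: "finite C" "card C = nat \<lceil>R0\<^sup>2 / \<rho>\<^sup>2\<rceil> + 1" "\<forall>c\<in>C. P c" "pairwise (\<lambda>c c'. dist c c' > 2 * \<rho>) C"
    using separated_finite_subset by blast
  have "R0\<^sup>2 / \<rho>\<^sup>2 < real (card C)" unfolding C(2) by linarith
  then have area: "real (card C) * \<rho>\<^sup>2 > R0\<^sup>2" using \<rho> by (simp add: field_simps)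
  obtain w1 w2 where w12: "\<And>c. c \<in> C \<Longrightarrow> w1 c \<in> \<Lambda> \<and> w2 c \<in> \<Lambda> \<and> w1 c \<noteq> w2 c \<and> cball c \<rho> \<subseteq> ball (w1 c) (r (w1 c)) \<inter> ball (w2 c) (r (w2 c))"
    using C(3) unfolding P_def by metis
  define W where "W z = disc_potential 0 R0 z - (\<Sum>c\<in>C. disc_potential c \<rho> z)" for z
  obtain B where B: "\<And>z. (cmod (f z))\<^sup>2 * exp (- \<alpha> * (cmod z)\<^sup>2) \<le> B"
    using Fock_space_weighted_bounded[OF \<alpha> fock] by blast
  define \<delta> where "\<delta> = (cmod (f z1))\<^sup>2 * exp (- \<alpha> * (cmod z1)\<^sup>2) * exp (\<alpha> * W z1)"
  have \<delta>: "\<delta> > 0" using z1 by (simp add: \<delta>_def)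
  have "(cmod (f z1))\<^sup>2 * exp (- \<alpha> * (cmod z1)\<^sup>2) > 0" using z1 by simp
  with B[of z1] have Bpos: "B > 0" by linarith
  \<comment> \<open>the constant makes \<open>B * exp (\<alpha> * W z)\<close> at most half of the fixed value \<open>\<delta>\<close>\<close>
  obtain R where R: "\<And>z. cmod z > R \<Longrightarrow> W z \<le> ln (\<delta> / (2 * B)) / \<alpha>"
    using disc_potential_diff_small_near_infinity[OF R0(1) \<rho> C(1) area] unfolding W_def by blast
  define R1 where "R1 = max R (cmod z1)"
  have Q1: "compact (cball 0 R1 - ball (0::complex) R0)" by (simp add: compact_diff)
  have Q2: "cball 0 R1 - ball 0 R0 \<subseteq> (\<Union>w\<in>\<Lambda>. ball w (r w))" using cover by blast
  obtain S1 where S1: "S1 \<subseteq> \<Lambda>" "finite S1" "cball 0 R1 - ball 0 R0 \<subseteq> (\<Union>w\<in>S1. ball w (r w))"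
    by (rule compactE_image[OF Q1 _ Q2]) auto
  \<comment> \<open>finitely many discs: those covering the annulus and those forming the chosen overlaps\<close>
  define S where "S = S1 \<union> w1 ` C \<union> w2 ` C"
  have S: "finite S" "S \<subseteq> \<Lambda>" using S1 C(1) w12 by (auto simp: S_def)
  define G where "G = ball 0 R0 \<union> (\<Union>w\<in>S. ball w (r w))"
  have G: "open G" "bounded G" using S by (auto simp: G_def)
  have RG: "cball 0 R1 \<subseteq> G" using S1(3) by (auto simp: G_def S_def)
  obtain F where F: "F holomorphic_on UNIV" "\<And>z. f z = F z * (\<Prod>w\<in>S. (z - w) ^ m w)"
    using entire_divide_zeros[OF S(1) f factor] S(2) by blast
  \<comment> \<open>the index \<open>None\<close> stands for the disc around the hole, which may coincide with one of the others\<close>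
  define a where "a i = (case i of None \<Rightarrow> 0 | Some w \<Rightarrow> w)" for i :: "complex option"
  define r' where "r' i = (case i of None \<Rightarrow> R0 | Some w \<Rightarrow> r w)" for i
  define I where "I = insert None (Some ` S)"
  define \<tau> where "\<tau> z = (\<Sum>i\<in>I. disc_potential (a i) (r' i) z) - (\<Sum>c\<in>C. disc_potential c \<rho> z) - (cmod z)\<^sup>2" for z
  have \<tau>_eq: "\<tau> z = (\<Sum>w\<in>S. disc_potential w (r w) z) + W z - (cmod z)\<^sup>2" for z
    using S(1) by (simp add: \<tau>_def I_def W_def a_def r'_def sum.reindex)
  have supp: "harmonic_support (\<lambda>z. \<alpha> * \<tau> z) p" if "p \<in> G" for p
    unfolding \<tau>_def
  proof (intro harmonic_support_cmult harmonic_support_balanced_discs)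
    show "r' i > 0" if "i \<in> I" for i using that R0 S rpos by (auto simp: I_def r'_def)
    show "\<exists>i\<in>I. p \<in> ball (a i) (r' i)" using that by (auto simp: G_def I_def a_def r'_def)
    show "\<exists>i\<in>I. \<exists>j\<in>I. i \<noteq> j \<and> cball c \<rho> \<subseteq> ball (a i) (r' i) \<inter> ball (a j) (r' j)" if "c \<in> C" for c
      using w12[OF that] that
      by (intro bexI[of _ "Some (w1 c)"] bexI[of _ "Some (w2 c)"]) (auto simp: I_def a_def r'_def S_def)
  qed (use \<alpha> S C \<rho> in \<open>auto simp: I_def\<close>)
  have cont: "continuous_on UNIV (\<lambda>z. \<alpha> * \<tau> z)"
    unfolding \<tau>_eq W_def using S rpos R0 \<rho> by (intro continuous_intros continuous_on_disc_potential) auto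
  have F2: "(\<lambda>z. (F z)\<^sup>2) holomorphic_on UNIV" using F by (intro holomorphic_intros)
  have "z1 \<in> G" using RG by (auto simp: R1_def)
  then obtain q where q: "q \<notin> G" "cmod ((F z1)\<^sup>2) * exp (\<alpha> * \<tau> z1) \<le> cmod ((F q)\<^sup>2) * exp (\<alpha> * \<tau> q)"
    using harmonic_support_maximum_principle[OF F2 cont G supp] by blast
  define k where "k = (\<Prod>w\<in>S. (exp 1 / (r w)\<^sup>2) ^ m w)"
  have k: "k > 0" unfolding k_def using S rpos by (intro prod_pos) fastforce
  have split: "cmod ((F z)\<^sup>2) * exp (\<alpha> * \<tau> z) =
      (cmod (F z))\<^sup>2 * (\<Prod>w\<in>S. exp (\<alpha> * disc_potential w (r w) z)) * exp (\<alpha> * W z) * exp (- \<alpha> * (cmod z)\<^sup>2)" for z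
    using S(1) by (simp add: \<tau>_eq norm_power distrib_left right_diff_distrib exp_add exp_diff exp_minus sum_distrib_left exp_sum field_simps)
  \<comment> \<open>off the discs the potentials restore the zeros that were divided out of \<open>f\<close>\<close>
  have kf: "(cmod (F z))\<^sup>2 * (\<Prod>w\<in>S. (exp 1 / (r w)\<^sup>2) ^ m w * ((cmod (z - w))\<^sup>2) ^ m w) = k * (cmod (f z))\<^sup>2" for z
  proof -
    have "(cmod (f z))\<^sup>2 = (cmod (F z))\<^sup>2 * (\<Prod>w\<in>S. ((cmod (z - w))\<^sup>2) ^ m w)"
      unfolding F(2)[of z]
      by (simp add: norm_mult prod_norm[symmetric] norm_power power_mult_distrib prod_power_distrib power_mult[symmetric] mult.commute)
    then show ?thesis by (simp add: k_def prod.distrib mult_ac)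
  qed
  have "k * \<delta> = (cmod (F z1))\<^sup>2 * (\<Prod>w\<in>S. (exp 1 / (r w)\<^sup>2) ^ m w * ((cmod (z1 - w))\<^sup>2) ^ m w)
      * exp (\<alpha> * W z1) * exp (- \<alpha> * (cmod z1)\<^sup>2)"
    unfolding kf \<delta>_def by (simp only: mult_ac)
  also have "\<dots> \<le> cmod ((F z1)\<^sup>2) * exp (\<alpha> * \<tau> z1)"
    unfolding split using S rpos mpos \<alpha> \<alpha>r
    by (intro mult_right_mono mult_left_mono prod_mono conjI exp_disc_potential_ge) auto
  also note q(2)
  also have "cmod ((F q)\<^sup>2) * exp (\<alpha> * \<tau> q) = k * ((cmod (f q))\<^sup>2 * exp (- \<alpha> * (cmod q)\<^sup>2)) * exp (\<alpha> * W q)"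
  proof -
    have on_q: "(\<Prod>w\<in>S. exp (\<alpha> * disc_potential w (r w) q)) = (\<Prod>w\<in>S. (exp 1 / (r w)\<^sup>2) ^ m w * ((cmod (q - w))\<^sup>2) ^ m w)"
    proof (rule prod.cong[OF refl])
      fix w assume w: "w \<in> S"
      then have "r w \<le> cmod (q - w)" using q(1) by (auto simp: G_def dist_norm norm_minus_commute not_less)
      then show "exp (\<alpha> * disc_potential w (r w) q) = (exp 1 / (r w)\<^sup>2) ^ m w * ((cmod (q - w))\<^sup>2) ^ m w"
        using w S rpos mpos \<alpha> \<alpha>r by (intro exp_disc_potential_outside) auto
    qed
    show ?thesis unfolding split on_q kf by (simp only: mult_ac)
  qed
  also have "\<dots> \<le> k * B * (\<delta> / (2 * B))"
  proof (intro mult_mono mult_left_mono B)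
    have "cmod q > R1" using q(1) RG by (auto simp: not_le)
    then have "W q \<le> ln (\<delta> / (2 * B)) / \<alpha>" using R by (simp add: R1_def)
    then have "\<alpha> * W q \<le> ln (\<delta> / (2 * B))" using \<alpha> by (simp add: field_simps)
    then show "exp (\<alpha> * W q) \<le> \<delta> / (2 * B)" using \<delta> Bpos by (metis divide_pos_pos exp_le_cancel_iff exp_ln mult_pos_pos zero_less_numeral)
  qed (use k Bpos in auto)
  also have "\<dots> = k * \<delta> / 2" using Bpos by simp
  finally show False using k \<delta> by simp
qed

end
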